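(* Consider the randomized gossip algorithm with unreliable communication on $n\ge 3$ nodes, with node pair selection matrix $A=[a_{ij}]$ and communication probabilities $\{P_k^+\}_{k\ge0},\{P_k^-\}_{k\ge0}$ (as defined in the context). Suppose that the underlying digraph $\mathcal{G}_0$ is weakly connected and that communication is perfectly dependent, i.e. for every $k$ the events $\mathbb{E}_k^+$ and $\mathbb{E}_k^-$ coincide up to a set of probability zero; write $P_k=P_k^+=P_k^-$. Then global a.s. consensus is achieved if and only if $\sum_{k=0}^\infty P_k=\infty$.
   Context: Network model. The node set is $\mathcal{V}=\{1,\dots,n\}$, $n\ge3$. $A=[a_{ij}]\in\mathbb{R}^{n\times n}$ is a stochastic matrix (nonnegative entries, each row sums to $1$). The underlying digraph is $\mathcal{G}_0=(\mathcal{V},\mathcal{E}_0)$ with $(j,i)\in\mathcal{E}_0$ if and only if $a_{ij}>0$. A digraph is weakly connected if it is connected as an undirected graph when arc directions are ignored. Node pair selection process. Independently at each time $k=0,1,2,\dots$, a node $i\in\mathcal{V}$ is drawn with probability $1/n$, and then node $i$ picks the (ordered) pair $(i,j)$ with probability $a_{ij}$. Node communication process. $\{P_k^+\}_{k\ge0}$ and $\{P_k^-\}_{k\ge0}$ are deterministic sequences in $[0,1]$. Independently over time, and independently of the node states and of the node pair selection process, $\mathbf{P}(\mathbb{E}_k^+)=P_k^+$ and $\mathbf{P}(\mathbb{E}_k^-)=P_k^-$, where $\mathbb{E}_k^+$ is the event that node $i$ receives $x_j(k)$ when $(i,j)$ is selected at time $k$, and $\mathbb{E}_k^-$ is the event that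 node $j$ receives $x_i(k)$ when $(i,j)$ is selected at time $k$. Algorithm. Let $k_0\ge0$ be an arbitrary integer initial time and $x(k_0)=x^0\in\mathbb{R}^n$ a deterministic initial condition. For $k\ge k_0$, $x_i(k+1)=\frac12x_i(k)+\frac12x_j(k)$ if $(i,j)$ or $(j,i)$ is selected at time $k$ and $i$ receives $x_j(k)$; otherwise $x_i(k+1)=x_i(k)$. Consensus. Let $\mathcal{H}(k)=\max_i x_i(k)-\min_i x_i(k)$. Global a.s. consensus is achieved if $\mathbf{P}(\lim_{k\to\infty}\mathcal{H}(k)=0)=1$ for any initial condition $x^0\in\mathbb{R}^n$ (with $k_0\ge 0$ arbitrary). *)

theory Defs
  imports "HOL-Probability.Probability" "Graph_Theory.Digraph_Component"
begin

definition stochastic_matrix :: "real ^ 'n ^ 'n \<Rightarrow> bool" where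
  "stochastic_matrix A \<longleftrightarrow> (\<forall>i j. 0 \<le> A $ i $ j) \<and> (\<forall>i. (\<Sum>j\<in>UNIV. A $ i $ j) = 1)"

(* Note the direction of the arcs: a positive entry A $ i $ j is an arc from j to i. *)
definition underlying_digraph :: "real ^ 'n ^ 'n \<Rightarrow> 'n pair_pre_digraph" where
  "underlying_digraph A = \<lparr> pverts = UNIV, parcs = {(j, i). 0 < A $ i $ j} \<rparr>"

(* The qualified constant is graph connectedness of the symmetric closure of G,
   not topological connectedness. *)
definition weakly_connected :: "'n pair_pre_digraph \<Rightarrow> bool" where
  "weakly_connected G \<longleftrightarrow> Digraph_Component.connected (with_proj G)"

(* sel k is the ordered pair selected at time k. When sel k = (i, j), the event Ep k says
   that i receives the state of j, and Em k says that j receives the state of i.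

   The probability of selecting (i, j) is that of drawing i uniformly, times A $ i $ j.

   The sum types in independent only serve to put the selections and the communication
   outcomes, over all times, into a single mutually independent family. The two
   events Ep k, Em k form one member of that family, so their joint law is arbitrary. *)
locale gossip_model = prob_space M
  for M :: "'a measure" and
    A :: "real ^ 'n ^ 'n" and
    Pp Pm :: "nat \<Rightarrow> real" and
    sel :: "nat \<Rightarrow> 'a \<Rightarrow> 'n \<times> 'n" and
    Ep Em :: "nat \<Rightarrow> 'a set" +
  assumes stochastic: "stochastic_matrix A"
    and Pp_range: "Pp k \<in> {0..1}"
    and Pm_range: "Pm k \<in> {0..1}"
    and sel_measurable: "sel k \<in> measurable M (count_space UNIV)"
    and Ep_event: "Ep k \<in> events"
    and Em_event: "Em k \<in> events"
    and prob_sel: "\<P>(\<omega> in M. sel k \<omega> = (i, j)) = 1 / real CARD('n) * A $ i $ j"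
    and prob_Ep: "prob (Ep k) = Pp k"
    and prob_Em: "prob (Em k) = Pm k"
    and independent: "indep_vars (\<lambda>_ :: nat + nat. count_space UNIV)
          (\<lambda>c \<omega>. case c of Inl k \<Rightarrow> Inl (sel k \<omega>) | Inr k \<Rightarrow> Inr (\<omega> \<in> Ep k, \<omega> \<in> Em k)) UNIV"

(* One update when (i, j) is selected; rp and rm say whether i, respectively j, receives
   the state of the other node. For i = j nothing changes. *)
definition gossip_step ::
    "'n::finite \<times> 'n \<Rightarrow> bool \<Rightarrow> bool \<Rightarrow> real ^ 'n \<Rightarrow> real ^ 'n" where
  "gossip_step p rp rm x = (case p of (i, j) \<Rightarrow>
     (\<chi> m. if m = i \<and> rp then 1/2 * x $ i + 1/2 * x $ j
           else if m = j \<and> rm then 1/2 * x $ j + 1/2 * x $ i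
           else x $ m))"

(* Indexed by absolute time k; the value at times k < k0 is a dummy, so that the state at
   time k0 is x0. *)
primrec gossip_state ::
    "(nat \<Rightarrow> 'a \<Rightarrow> 'n::finite \<times> 'n) \<Rightarrow> (nat \<Rightarrow> 'a set) \<Rightarrow> (nat \<Rightarrow> 'a set) \<Rightarrow>
     nat \<Rightarrow> real ^ 'n \<Rightarrow> 'a \<Rightarrow> nat \<Rightarrow> real ^ 'n" where
  "gossip_state sel Ep Em k0 x0 \<omega> 0 = x0"
| "gossip_state sel Ep Em k0 x0 \<omega> (Suc k) =
     (if k < k0 then x0
      else gossip_step (sel k \<omega>) (\<omega> \<in> Ep k) (\<omega> \<in> Em k) (gossip_state sel Ep Em k0 x0 \<omega> k))"

definition spread :: "real ^ 'n \<Rightarrow> real" where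
  "spread x = Max (range (\<lambda>i. x $ i)) - Min (range (\<lambda>i. x $ i))"

definition global_as_consensus ::
    "'a measure \<Rightarrow> (nat \<Rightarrow> 'a \<Rightarrow> 'n::finite \<times> 'n) \<Rightarrow> (nat \<Rightarrow> 'a set) \<Rightarrow> (nat \<Rightarrow> 'a set) \<Rightarrow>
     nat \<Rightarrow> bool" where
  "global_as_consensus M sel Ep Em k0 \<longleftrightarrow>
     (\<forall>x0 :: real ^ 'n.
        \<P>(\<omega> in M. (\<lambda>k. spread (gossip_state sel Ep Em k0 x0 \<omega> k)) \<longlonglongrightarrow> 0) = 1)"

end

theory Submission
  imports Defs
begin

text \<open>If communication succeeds at time \<open>k\<close> on the pair \<open>(i, j)\<close>, it lowers
  \<open>V(x) = \<Sum>\<^sub>i\<^sub>j (x\<^sub>i - x\<^sub>j)\<^sup>2\<close> by \<open>n (x\<^sub>i - x\<^sub>j)\<^sup>2\<close>, because averaging is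
  symmetric. Since the selection at time \<open>k\<close> is independent of the state, \<open>E V\<close> drops by \<open>P\<^sub>k E D\<close>
  with \<open>D(x) = \<Sum>\<^sub>i\<^sub>j a\<^sub>i\<^sub>j (x\<^sub>i - x\<^sub>j)\<^sup>2\<close>, and weak connectivity gives a Poincare inequality
  \<open>V \<le> C D\<close>. Hence \<open>E V \<le> V(x\<^sup>0) exp (- \<Sum> P\<^sub>k / C)\<close>, which tends to \<open>0\<close> if \<open>\<Sum> P\<^sub>k\<close> diverges;
  as \<open>V\<close> is almost surely nonincreasing, it tends to \<open>0\<close> almost surely.

  If \<open>\<Sum> P\<^sub>k\<close> converges, then with positive probability one fixed pair is selected at every time
  up to some \<open>K\<close> and no communication succeeds after \<open>K\<close>. A third node, started at another value
  than that pair, then never changes its state.\<close>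

section \<open>The pairwise energy, the spread and one averaging step\<close>

definition pair_energy :: "real ^ 'n \<Rightarrow> real" where
  "pair_energy x = (\<Sum>i\<in>UNIV. \<Sum>j\<in>UNIV. (x $ i - x $ j)\<^sup>2)"

lemma pair_energy_nonneg: "0 \<le> pair_energy x"
  by (simp add: pair_energy_def sum_nonneg)

text \<open>Expanding the squares separates the first moment, which two-sided averaging preserves,
  from the second, which it lowers.\<close>

lemma pair_energy_moments:
  fixes x :: "real ^ 'n"
  shows "pair_energy x =
    2 * (real CARD('n) * (\<Sum>i\<in>UNIV. (x $ i)\<^sup>2) - (\<Sum>i\<in>UNIV. x $ i)\<^sup>2)"
proof -
  have "pair_energy x =
      (\<Sum>i\<in>UNIV. \<Sum>j\<in>UNIV. (x $ i)\<^sup>2 + (x $ j)\<^sup>2 - 2 * (x $ i * x $ j))"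
    unfolding pair_energy_def by (simp add: power2_diff mult.assoc)
  also have "\<dots> = 2 * (real CARD('n) * (\<Sum>i\<in>UNIV. (x $ i)\<^sup>2))
      - 2 * ((\<Sum>i\<in>UNIV. x $ i) * (\<Sum>i\<in>UNIV. x $ i))"
    by (simp add: sum.distrib sum_subtractf sum_product flip: sum_distrib_left)
  finally show ?thesis by (simp add: power2_eq_square)
qed

lemma square_diff_le_pair_energy: "(x $ i - x $ j)\<^sup>2 \<le> pair_energy x"
proof -
  have "(x $ i - x $ j)\<^sup>2 \<le> (\<Sum>j\<in>UNIV. (x $ i - x $ j)\<^sup>2)"
    by (rule member_le_sum) auto
  also have "\<dots> \<le> pair_energy x"
    unfolding pair_energy_def
    by (rule member_le_sum[where f = "\<lambda>i. \<Sum>j\<in>UNIV. (x $ i - x $ j)\<^sup>2"]) (auto intro: sum_nonneg)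
  finally show ?thesis .
qed

lemma spread_attained: "\<exists>i j. spread x = x $ i - x $ j"
proof -
  have "Max (range (\<lambda>i. x $ i)) \<in> range (\<lambda>i. x $ i)"
    "Min (range (\<lambda>i. x $ i)) \<in> range (\<lambda>i. x $ i)"
    by (auto intro: Max_in Min_in)
  then show ?thesis
    unfolding spread_def by (metis imageE)
qed

lemma diff_le_spread: "x $ i - x $ j \<le> spread x"
proof -
  have "x $ i \<le> Max (range (\<lambda>i. x $ i))" "Min (range (\<lambda>i. x $ i)) \<le> x $ j"
    by auto
  then show ?thesis
    unfolding spread_def by linarith
qed

text \<open>The spread is a single difference of coordinates, and its square is one summand of the
  energy. Convergence of the energy to 0 thus carries over to the spread.\<close>

lemma abs_spread_le: "\<bar>spread x\<bar> \<le> sqrt (pair_energy x)"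
proof -
  obtain i j where "spread x = x $ i - x $ j"
    using spread_attained by blast
  then show ?thesis
    using square_diff_le_pair_energy[of x i j] by (metis real_sqrt_abs real_sqrt_le_iff)
qed

lemma gossip_step_trivial:
  "x $ i = x $ j \<Longrightarrow> gossip_step (i, j) rp rm x = x"
  "gossip_step p False False x = x"
  by (auto simp: gossip_step_def vec_eq_iff split: prod.split)

text \<open>Averaging at both nodes preserves the coordinate sum and lowers the sum of squares by
  half the squared difference; the factor \<open>2 * real CARD('n)\<close> of the moment formula
  turns this into the stated loss.\<close>

lemma pair_energy_gossip_step:
  fixes x :: "real ^ 'n"
  shows "pair_energy (gossip_step (i, j) True True x) =
    pair_energy x - real CARD('n) * (x $ i - x $ j)\<^sup>2"
proof (cases "i = j")
  case True
  then show ?thesis by (simp add: gossip_step_trivial)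
next
  case False
  define y where "y = gossip_step (i, j) True True x"
  have y: "y $ m = (if m = i \<or> m = j then (x $ i + x $ j) / 2 else x $ m)" for m
    by (auto simp: y_def gossip_step_def field_simps)
  \<comment> \<open>Separates the only two coordinates that change. They must be distinct, hence the
    case distinction.\<close>
  have split: "(\<Sum>m\<in>UNIV. f m) = f i + f j + (\<Sum>m\<in>UNIV - {i, j}. f m)" for f :: "'n \<Rightarrow> real"
    using False sum.subset_diff[of "{i, j}" UNIV f] by simp
  have "(\<Sum>m\<in>UNIV. y $ m) = (\<Sum>m\<in>UNIV. x $ m)"
    unfolding split[of "\<lambda>m. y $ m"] split[of "\<lambda>m. x $ m"] by (simp add: y)
  moreover have "(\<Sum>m\<in>UNIV. (y $ m)\<^sup>2) = (\<Sum>m\<in>UNIV. (x $ m)\<^sup>2) - (x $ i - x $ j)\<^sup>2 / 2"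
    unfolding split[of "\<lambda>m. (y $ m)\<^sup>2"] split[of "\<lambda>m. (x $ m)\<^sup>2"]
    by (simp add: y) (simp add: power2_eq_square field_simps)
  ultimately show ?thesis
    unfolding y_def[symmetric] pair_energy_moments by (simp add: right_diff_distrib)
qed

section \<open>The Dirichlet form and the Poincare inequality\<close>

text \<open>Apart from the factor \<open>Pp k\<close>, this is the expected energy loss in one step:
  the factor \<open>real CARD('n)\<close> of the loss cancels against the uniform draw of the first
  node.\<close>

definition dirichlet_form :: "real ^ 'n ^ 'n \<Rightarrow> real ^ 'n \<Rightarrow> real" where
  "dirichlet_form A x = (\<Sum>i\<in>UNIV. \<Sum>j\<in>UNIV. A $ i $ j * (x $ i - x $ j)\<^sup>2)"

lemma stochastic_entry_nonneg: "stochastic_matrix A \<Longrightarrow> 0 \<le> A $ i $ j"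
  by (simp add: stochastic_matrix_def)

lemma dirichlet_form_nonneg: "stochastic_matrix A \<Longrightarrow> 0 \<le> dirichlet_form A x"
  by (simp add: dirichlet_form_def sum_nonneg stochastic_entry_nonneg)

lemma dirichlet_form_ge_entry:
  assumes "stochastic_matrix A"
  shows "A $ i $ j * (x $ i - x $ j)\<^sup>2 \<le> dirichlet_form A x"
proof -
  have "A $ i $ j * (x $ i - x $ j)\<^sup>2 \<le> (\<Sum>j\<in>UNIV. A $ i $ j * (x $ i - x $ j)\<^sup>2)"
    by (rule member_le_sum[where f = "\<lambda>j. A $ i $ j * (x $ i - x $ j)\<^sup>2"])
      (auto simp: stochastic_entry_nonneg assms)
  also have "\<dots> \<le> dirichlet_form A x"
    unfolding dirichlet_form_def
    by (rule member_le_sum[where f = "\<lambda>i. \<Sum>j\<in>UNIV. A $ i $ j * (x $ i - x $ j)\<^sup>2"])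
      (auto intro!: sum_nonneg simp: stochastic_entry_nonneg assms)
  finally show ?thesis .
qed

text \<open>A positive entry bounds the squared difference across its own arc, and the constants are
  combined along a path from \<open>u\<close> to \<open>v\<close>. Squared differences ignore
  orientation, so the path may use arcs in either direction.\<close>

lemma square_diff_le_dirichlet_form:
  fixes A :: "real ^ 'n ^ 'n"
  assumes A: "stochastic_matrix A" and conn: "weakly_connected (underlying_digraph A)"
  shows "\<exists>C\<ge>0. \<forall>x. (x $ u - x $ v)\<^sup>2 \<le> C * dirichlet_form A x"
proof -
  have edge: "\<exists>C\<ge>0. \<forall>x. (x $ i - x $ j)\<^sup>2 \<le> C * dirichlet_form A x" if "0 < A $ i $ j" for i j
  proof (intro exI[of _ "1 / A $ i $ j"] conjI allI)
    fix x :: "real ^ 'n"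
    show "(x $ i - x $ j)\<^sup>2 \<le> 1 / A $ i $ j * dirichlet_form A x"
      using dirichlet_form_ge_entry[OF A, of i j x] that by (simp add: field_simps)
  qed (use that in simp)
  \<comment> \<open>Connectedness is strong connectedness of the symmetric closure, so unfolding
    yields reachability along arcs and reversed arcs.\<close>
  have "(u, v) \<in> rtrancl_on UNIV (\<Union>(i, j)\<in>{(i, j). 0 < A $ j $ i}. {(i, j), (j, i)})"
    using conn
    by (simp add: weakly_connected_def Digraph_Component.connected_def strongly_connected_def
        mk_symmetric_def underlying_digraph_def reachable_def case_prod_unfold)
  then show ?thesis
  proof (induction rule: rtrancl_on_induct)
    case base
    show ?case by (auto intro: exI[of _ 0])
  next
    case (step y z)
    obtain C where C: "C \<ge> 0" "\<And>x. (x $ u - x $ y)\<^sup>2 \<le> C * dirichlet_form A x"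
      using step by blast
    have "\<exists>C\<ge>0. \<forall>x. (x $ y - x $ z)\<^sup>2 \<le> C * dirichlet_form A x"
      using step(2) edge[of y z] edge[of z y] by (auto simp: power2_commute[of "_ $ y"])
    then obtain C' where C': "C' \<ge> 0" "\<And>x. (x $ y - x $ z)\<^sup>2 \<le> C' * dirichlet_form A x"
      by blast
    have "(x $ u - x $ z)\<^sup>2 \<le> (2 * C + 2 * C') * dirichlet_form A x" for x
    proof -
      \<comment> \<open>The inequality \<open>(a + b)^2 \<le> 2 * a^2 + 2 * b^2\<close> is the
        source of the constant \<open>2 * C + 2 * C'\<close>.\<close>
      have "(x $ u - x $ z)\<^sup>2 \<le> 2 * (x $ u - x $ y)\<^sup>2 + 2 * (x $ y - x $ z)\<^sup>2"
        using sum_squares_bound[of "x $ u - x $ y" "x $ y - x $ z"]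
          power2_sum[of "x $ u - x $ y" "x $ y - x $ z"] by simp
      also have "\<dots> \<le> (2 * C + 2 * C') * dirichlet_form A x"
        using C(2)[of x] C'(2)[of x] by (simp add: algebra_simps)
      finally show ?thesis .
    qed
    then show ?case
      using C(1) C'(1) by (intro exI[of _ "2 * C + 2 * C'"]) auto
  qed
qed

lemma pair_energy_le_dirichlet_form:
  fixes A :: "real ^ 'n ^ 'n"
  assumes A: "stochastic_matrix A" and conn: "weakly_connected (underlying_digraph A)"
  shows "\<exists>C\<ge>1. \<forall>x. pair_energy x \<le> C * dirichlet_form A x"
proof -
  obtain C where C: "\<And>u v. C u v \<ge> 0"
    "\<And>u v x. (x $ u - x $ v)\<^sup>2 \<le> C u v * dirichlet_form A x"
    using square_diff_le_dirichlet_form[OF assms] by metis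
  \<comment> \<open>The added 1 makes the constant at least 1, so that it can serve as a divisor in
    the decay rate.\<close>
  let ?C = "1 + (\<Sum>u\<in>UNIV. \<Sum>v\<in>UNIV. C u v)"
  have "pair_energy x \<le> ?C * dirichlet_form A x" for x
  proof -
    have "pair_energy x \<le> (\<Sum>u\<in>UNIV. \<Sum>v\<in>UNIV. C u v * dirichlet_form A x)"
      unfolding pair_energy_def by (intro sum_mono C)
    also have "\<dots> = (\<Sum>u\<in>UNIV. \<Sum>v\<in>UNIV. C u v) * dirichlet_form A x"
      by (simp add: sum_distrib_right)
    also have "\<dots> \<le> ?C * dirichlet_form A x"
      by (intro mult_right_mono dirichlet_form_nonneg A) simp
    finally show ?thesis .
  qed
  then show ?thesis
    by (intro exI[of _ ?C]) (auto intro!: sum_nonneg C)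
qed

section \<open>Dependence of the state on past observations, and its measurability\<close>

text \<open>Only observations before \<open>k\<close> enter the recursion up to \<open>k\<close>.
  The two sides may live on different sample spaces, so a trajectory can be compared with the
  recursion run on a product space.\<close>

lemma gossip_state_cong:
  assumes "\<And>j. j < k \<Longrightarrow> sel j \<omega> = sel' j \<omega>'"
    and "\<And>j. j < k \<Longrightarrow> \<omega> \<in> Ep j \<longleftrightarrow> \<omega>' \<in> Ep' j"
    and "\<And>j. j < k \<Longrightarrow> \<omega> \<in> Em j \<longleftrightarrow> \<omega>' \<in> Em' j"
  shows "gossip_state sel Ep Em k0 x0 \<omega> k = gossip_state sel' Ep' Em' k0 x0 \<omega>' k"
  using assms by (induction k) auto

text \<open>Finitely many discrete observations determine the state, so measurability holds even
  into the discrete space; every function of the state is then measurable.\<close>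

lemma measurable_gossip_state:
  fixes sel :: "nat \<Rightarrow> 'a \<Rightarrow> 'n::finite \<times> 'n"
  assumes "\<And>j. j < k \<Longrightarrow> sel j \<in> measurable N (count_space UNIV)"
    and "\<And>j. j < k \<Longrightarrow> Measurable.pred N (\<lambda>\<omega>. \<omega> \<in> Ep j)"
    and "\<And>j. j < k \<Longrightarrow> Measurable.pred N (\<lambda>\<omega>. \<omega> \<in> Em j)"
  shows "(\<lambda>\<omega>. gossip_state sel Ep Em k0 x0 \<omega> k) \<in> measurable N (count_space UNIV)"
  using assms
proof (induction k)
  case 0
  then show ?case by simp
next
  case (Suc k)
  let ?S = "\<lambda>\<omega>. gossip_state sel Ep Em k0 x0 \<omega> k"
  have S: "?S \<in> measurable N (count_space UNIV)"
    using Suc by simp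
  have pred: "Measurable.pred N (\<lambda>\<omega>. \<omega> \<in> Ep k)" "Measurable.pred N (\<lambda>\<omega>. \<omega> \<in> Em k)"
    and sel: "sel k \<in> measurable N (count_space UNIV)"
    using Suc.prems by auto
  \<comment> \<open>Once the selection and the two receptions are fixed, the update is one map
    applied to the previous state; countably many such cases are then glued together.\<close>
  have step: "(\<lambda>\<omega>. gossip_step p a b (?S \<omega>)) \<in> measurable N (count_space UNIV)" for p a b
    by (rule measurable_compose[OF S]) simp
  have "(\<lambda>\<omega>. gossip_step (sel k \<omega>) (\<omega> \<in> Ep k) (\<omega> \<in> Em k) (?S \<omega>))
      \<in> measurable N (count_space UNIV)"
    by (rule measurable_compose_countable[OF _ sel],
        rule measurable_compose_countable[OF _ pred(1)],
        rule measurable_compose_countable[OF _ pred(2)], rule step)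
  then show ?case by simp
qed

lemma gossip_state_stationary:
  assumes "\<And>k. gossip_step (sel k \<omega>) (\<omega> \<in> Ep k) (\<omega> \<in> Em k) x0 = x0"
  shows "gossip_state sel Ep Em k0 x0 \<omega> k = x0"
  using assms by (induction k) auto

section \<open>Independence of the current selection from the state\<close>

context gossip_model
begin

abbreviation obs :: "nat + nat \<Rightarrow> 'a \<Rightarrow> ('n \<times> 'n) + (bool \<times> bool)" where
  "obs c \<omega> \<equiv> (case c of Inl k \<Rightarrow> Inl (sel k \<omega>) | Inr k \<Rightarrow> Inr (\<omega> \<in> Ep k, \<omega> \<in> Em k))"

lemma pred_Ep: "Measurable.pred M (\<lambda>\<omega>. \<omega> \<in> Ep k)"
  and pred_Em: "Measurable.pred M (\<lambda>\<omega>. \<omega> \<in> Em k)"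
  using Ep_event[of k] Em_event[of k] by (auto intro: pred_sets2)

lemma measurable_state:
  "(\<lambda>\<omega>. gossip_state sel Ep Em k0 x0 \<omega> k) \<in> measurable M (count_space UNIV)"
  by (intro measurable_gossip_state sel_measurable pred_Ep pred_Em)

lemma measurable_state_fun:
  "(\<lambda>\<omega>. f (gossip_state sel Ep Em k0 x0 \<omega> k)) \<in> borel_measurable M"
  by (rule measurable_compose[OF measurable_state]) simp

text \<open>Blocks of observations over disjoint index sets are independent. This serves for
  selection against reception, past against present, and early selections against late
  receptions.\<close>

lemma indep_var_obs:
  "I \<inter> J = {} \<Longrightarrow> indep_var (PiM I (\<lambda>_. count_space UNIV)) (\<lambda>\<omega>. restrict (\<lambda>c. obs c \<omega>) I)
     (PiM J (\<lambda>_. count_space UNIV)) (\<lambda>\<omega>. restrict (\<lambda>c. obs c \<omega>) J)"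
  by (rule indep_var_restrict[OF independent]) auto

lemma prob_sel_Ep:
  "prob {\<omega> \<in> space M. sel k \<omega> = (i, j) \<and> \<omega> \<in> Ep k} = A $ i $ j * Pp k / real CARD('n)"
proof -
  let ?N = "\<lambda>c. PiM {c} (\<lambda>_. count_space UNIV) :: (nat + nat \<Rightarrow> ('n \<times> 'n) + (bool \<times> bool)) measure"
  let ?X = "{z \<in> space (?N (Inl k)). z (Inl k) = Inl (i, j)}"
  \<comment> \<open>The second flag stays free: both receptions form one observation, and only the
    marginal of \<open>Ep k\<close> is wanted.\<close>
  let ?Y = "{z \<in> space (?N (Inr k)). z (Inr k) \<in> range (\<lambda>b. Inr (True, b))}"
  have sets: "?X \<in> sets (?N (Inl k))" "?Y \<in> sets (?N (Inr k))"
    by measurable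
  have "prob {\<omega> \<in> space M. sel k \<omega> = (i, j) \<and> \<omega> \<in> Ep k} =
      prob ((\<lambda>\<omega>. (restrict (\<lambda>c. obs c \<omega>) {Inl k}, restrict (\<lambda>c. obs c \<omega>) {Inr k})) -` (?X \<times> ?Y)
        \<inter> space M)"
    by (rule arg_cong[where f = prob]) (auto simp: space_PiM)
  also have "\<dots> = prob ((\<lambda>\<omega>. restrict (\<lambda>c. obs c \<omega>) {Inl k}) -` ?X \<inter> space M)
      * prob ((\<lambda>\<omega>. restrict (\<lambda>c. obs c \<omega>) {Inr k}) -` ?Y \<inter> space M)"
    by (intro indep_varD[OF indep_var_obs] sets) auto
  also have "(\<lambda>\<omega>. restrict (\<lambda>c. obs c \<omega>) {Inl k}) -` ?X \<inter> space M
      = {\<omega> \<in> space M. sel k \<omega> = (i, j)}"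
    by (auto simp: space_PiM)
  also have "(\<lambda>\<omega>. restrict (\<lambda>c. obs c \<omega>) {Inr k}) -` ?Y \<inter> space M = Ep k"
    using sets.sets_into_space[OF Ep_event[of k]] by (auto simp: space_PiM)
  finally show ?thesis
    by (simp add: prob_sel prob_Ep)
qed

text \<open>The two variables use observations before \<open>k\<close> and at \<open>k\<close>
  respectively. Taking an indicator as the second variable lets expectations of products
  factor.\<close>

lemma indep_state_selection:
  fixes f :: "real ^ 'n \<Rightarrow> real"
  shows "indep_var borel (\<lambda>\<omega>. f (gossip_state sel Ep Em k0 x0 \<omega> k))
    borel (indicator {\<omega>. sel k \<omega> = p \<and> \<omega> \<in> Ep k} :: 'a \<Rightarrow> real)"
proof -
  let ?I = "Inl ` {..<k} \<union> Inr ` {..<k} :: (nat + nat) set"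
  let ?J = "{Inl k, Inr k} :: (nat + nat) set"
  let ?N = "\<lambda>K. PiM K (\<lambda>_. count_space UNIV) :: (nat + nat \<Rightarrow> ('n \<times> 'n) + (bool \<times> bool)) measure"
  \<comment> \<open>The state at time \<open>k\<close> is a function \<open>?F\<close> of the observations before \<open>k\<close>, namely the
    gossip recursion run on the product space of those observations.\<close>
  let ?sel = "\<lambda>j z. projl (z (Inl j) :: ('n \<times> 'n) + (bool \<times> bool))"
  let ?Ep = "\<lambda>j. {z. fst (projr (z (Inr j) :: ('n \<times> 'n) + (bool \<times> bool)))}"
  let ?Em = "\<lambda>j. {z. snd (projr (z (Inr j) :: ('n \<times> 'n) + (bool \<times> bool)))}"
  let ?F = "\<lambda>z. f (gossip_state ?sel ?Ep ?Em k0 x0 z k)"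
  \<comment> \<open>Written as a product of functions of one coordinate each, so that measurability
    reduces to the coordinates.\<close>
  let ?G = "\<lambda>z. of_bool (z (Inl k) = Inl p) * of_bool (z (Inr k) \<in> range (\<lambda>b. Inr (True, b))) :: real"
  have comp: "(\<lambda>z. g (z c)) \<in> measurable (?N K) (count_space UNIV)" if "c \<in> K"
    for c K and g :: "('n \<times> 'n) + (bool \<times> bool) \<Rightarrow> 'c"
    by (rule measurable_compose[OF measurable_component_singleton[OF that]]) simp
  have comp': "(\<lambda>z. g (z c)) \<in> borel_measurable (?N K)" if "c \<in> K"
    for c K and g :: "('n \<times> 'n) + (bool \<times> bool) \<Rightarrow> real"
    by (rule measurable_compose[OF measurable_component_singleton[OF that]]) simp
  have "(\<lambda>z. gossip_state ?sel ?Ep ?Em k0 x0 z k) \<in> measurable (?N ?I) (count_space UNIV)"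
    by (intro measurable_gossip_state) (auto intro!: comp)
  then have F: "?F \<in> borel_measurable (?N ?I)"
    by (rule measurable_compose) simp
  have G: "?G \<in> borel_measurable (?N ?J)"
    by (intro borel_measurable_times comp') auto
  have "indep_var borel (?F \<circ> (\<lambda>\<omega>. restrict (\<lambda>c. obs c \<omega>) ?I))
      borel (?G \<circ> (\<lambda>\<omega>. restrict (\<lambda>c. obs c \<omega>) ?J))"
    by (rule indep_var_compose[OF indep_var_obs F G]) auto
  moreover have "?F \<circ> (\<lambda>\<omega>. restrict (\<lambda>c. obs c \<omega>) ?I)
      = (\<lambda>\<omega>. f (gossip_state sel Ep Em k0 x0 \<omega> k))"
    by (auto simp: fun_eq_iff intro!: arg_cong[where f = f] gossip_state_cong)
  moreover have "?G \<circ> (\<lambda>\<omega>. restrict (\<lambda>c. obs c \<omega>) ?J)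
      = indicator {\<omega>. sel k \<omega> = p \<and> \<omega> \<in> Ep k}"
    by (auto simp: fun_eq_iff indicator_def)
  ultimately show ?thesis
    by simp
qed

lemma measurable_selection:
  "(indicator {\<omega>. sel k \<omega> = p \<and> \<omega> \<in> Ep k} :: 'a \<Rightarrow> real) \<in> borel_measurable M"
  using indep_var_rv2[OF indep_state_selection] .

lemma integrable_selection:
  "integrable M (indicator {\<omega>. sel k \<omega> = p \<and> \<omega> \<in> Ep k} :: 'a \<Rightarrow> real)"
  by (rule integrable_const_bound[where B = 1]) (auto simp: measurable_selection indicator_def)

lemma integrable_state_selection:
  fixes f :: "real ^ 'n \<Rightarrow> real"
  assumes "integrable M (\<lambda>\<omega>. f (gossip_state sel Ep Em k0 x0 \<omega> k))"
  shows "integrable M (\<lambda>\<omega>. f (gossip_state sel Ep Em k0 x0 \<omega> k) *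
      indicator {\<omega>. sel k \<omega> = p \<and> \<omega> \<in> Ep k} \<omega>)"
  by (rule indep_var_integrable[OF indep_state_selection assms integrable_selection])

lemma expectation_state_selection:
  fixes f :: "real ^ 'n \<Rightarrow> real"
  assumes "integrable M (\<lambda>\<omega>. f (gossip_state sel Ep Em k0 x0 \<omega> k))"
  shows "expectation (\<lambda>\<omega>. f (gossip_state sel Ep Em k0 x0 \<omega> k) *
      indicator {\<omega>. sel k \<omega> = (i, j) \<and> \<omega> \<in> Ep k} \<omega>) =
    expectation (\<lambda>\<omega>. f (gossip_state sel Ep Em k0 x0 \<omega> k)) * (A $ i $ j * Pp k / real CARD('n))"
proof -
  have "{\<omega>. sel k \<omega> = (i, j) \<and> \<omega> \<in> Ep k} \<inter> space M =
      {\<omega> \<in> space M. sel k \<omega> = (i, j) \<and> \<omega> \<in> Ep k}"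
    by auto
  then have "expectation (indicator {\<omega>. sel k \<omega> = (i, j) \<and> \<omega> \<in> Ep k}) =
      A $ i $ j * Pp k / real CARD('n)"
    by (simp add: prob_sel_Ep)
  then show ?thesis
    by (simp add: indep_var_lebesgue_integral[OF indep_state_selection assms integrable_selection])
qed

section \<open>The energy along a trajectory\<close>

lemma gossip_state_initial: "k \<le> k0 \<Longrightarrow> gossip_state sel Ep Em k0 x0 \<omega> k = x0"
  by (induction k) auto

text \<open>Only the selected pair contributes to the double sum. Summing over all pairs writes the
  loss as products of a function of the state and an indicator independent of it.\<close>

lemma pair_energy_state_Suc:
  fixes x0 :: "real ^ 'n"
  assumes "\<omega> \<in> Ep k \<longleftrightarrow> \<omega> \<in> Em k" "k0 \<le> k"
  defines "x \<equiv> gossip_state sel Ep Em k0 x0 \<omega> k"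
  shows "pair_energy (gossip_state sel Ep Em k0 x0 \<omega> (Suc k)) = pair_energy x -
    (\<Sum>i\<in>UNIV. \<Sum>j\<in>UNIV. real CARD('n) * ((x $ i - x $ j)\<^sup>2 *
      indicator {\<omega>. sel k \<omega> = (i, j) \<and> \<omega> \<in> Ep k} \<omega>))"
proof -
  obtain a b where ab: "sel k \<omega> = (a, b)"
    by (cases "sel k \<omega>")
  \<comment> \<open>The nested conditionals have the form in which both sums collapse to the term at
    \<open>(a, b)\<close>.\<close>
  have "real CARD('n) * ((x $ i - x $ j)\<^sup>2 *
      indicator {\<omega>. sel k \<omega> = (i, j) \<and> \<omega> \<in> Ep k} \<omega>) = (if j = b then if i = a
      then of_bool (\<omega> \<in> Ep k) * (real CARD('n) * (x $ a - x $ b)\<^sup>2) else 0 else 0)" for i j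
    using ab by (simp add: indicator_def)
  then have loss: "(\<Sum>i\<in>UNIV. \<Sum>j\<in>UNIV. real CARD('n) * ((x $ i - x $ j)\<^sup>2 *
      indicator {\<omega>. sel k \<omega> = (i, j) \<and> \<omega> \<in> Ep k} \<omega>)) =
    of_bool (\<omega> \<in> Ep k) * (real CARD('n) * (x $ a - x $ b)\<^sup>2)"
    by simp
  show ?thesis
    unfolding loss using assms ab
    by (cases "\<omega> \<in> Ep k") (simp_all add: pair_energy_gossip_step gossip_step_trivial)
qed

text \<open>Monotonicity holds along each single path whose receptions coincide; this later upgrades
  convergence of expectations to almost sure convergence.\<close>

lemma pair_energy_state_decseq:
  assumes "\<And>k. \<omega> \<in> Ep k \<longleftrightarrow> \<omega> \<in> Em k"
  shows "decseq (\<lambda>k. pair_energy (gossip_state sel Ep Em k0 x0 \<omega> k))"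
proof (rule decseq_SucI)
  fix k
  show "pair_energy (gossip_state sel Ep Em k0 x0 \<omega> (Suc k)) \<le>
      pair_energy (gossip_state sel Ep Em k0 x0 \<omega> k)"
  proof (cases "k0 \<le> k")
    case True
    then show ?thesis
      by (subst pair_energy_state_Suc) (auto intro!: sum_nonneg simp: assms)
  qed (simp add: gossip_state_initial)
qed

section \<open>Decay of the expected energy and almost sure consensus\<close>

context
  assumes dependent: "\<And>k. AE \<omega> in M. \<omega> \<in> Ep k \<longleftrightarrow> \<omega> \<in> Em k"
begin

lemma AE_dependent: "AE \<omega> in M. \<forall>k. \<omega> \<in> Ep k \<longleftrightarrow> \<omega> \<in> Em k"
  using dependent by (simp add: AE_all_countable)

lemma AE_pair_energy_le:
  "AE \<omega> in M. pair_energy (gossip_state sel Ep Em k0 x0 \<omega> k) \<le> pair_energy x0"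
  using AE_dependent
proof eventually_elim
  case (elim \<omega>)
  then show ?case
    using decseqD[OF pair_energy_state_decseq, of \<omega> 0 k k0 x0] by simp
qed

lemma integrable_pair_energy:
  "integrable M (\<lambda>\<omega>. pair_energy (gossip_state sel Ep Em k0 x0 \<omega> k))"
  using AE_pair_energy_le
  by (intro integrable_const_bound[where B = "pair_energy x0"] measurable_state_fun)
    (auto simp: pair_energy_nonneg)

lemma integrable_square_diff:
  "integrable M (\<lambda>\<omega>. (gossip_state sel Ep Em k0 x0 \<omega> k $ i - gossip_state sel Ep Em k0 x0 \<omega> k $ j)\<^sup>2)"
  by (rule Bochner_Integration.integrable_bound[OF integrable_pair_energy[of k0 x0 k] measurable_state_fun])
    (auto simp: pair_energy_nonneg square_diff_le_pair_energy)

text \<open>By independence, the expected loss at \<open>(i, j)\<close> is the expected squared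
  difference times \<open>real CARD('n)\<close> times the probability
  \<open>A $ i $ j * Pp k / real CARD('n)\<close>; summation gives the Dirichlet form.\<close>

lemma expectation_pair_energy_Suc:
  fixes x0 :: "real ^ 'n"
  assumes "k0 \<le> k"
  defines "S \<equiv> gossip_state sel Ep Em k0 x0"
  shows "expectation (\<lambda>\<omega>. pair_energy (S \<omega> (Suc k))) = expectation (\<lambda>\<omega>. pair_energy (S \<omega> k))
    - Pp k * expectation (\<lambda>\<omega>. dirichlet_form A (S \<omega> k))"
proof -
  let ?d = "\<lambda>i j \<omega>. (S \<omega> k $ i - S \<omega> k $ j)\<^sup>2"
  let ?I = "\<lambda>i j. indicator {\<omega>. sel k \<omega> = (i, j) \<and> \<omega> \<in> Ep k} :: 'a \<Rightarrow> real"
  have int: "integrable M (?d i j)" "integrable M (\<lambda>\<omega>. ?d i j \<omega> * ?I i j \<omega>)" for i j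
    unfolding S_def
    by (rule integrable_square_diff,
        rule integrable_state_selection[OF integrable_square_diff])
  have exp: "expectation (\<lambda>\<omega>. ?d i j \<omega> * ?I i j \<omega>) =
      expectation (?d i j) * (A $ i $ j * Pp k / real CARD('n))" for i j
    unfolding S_def by (rule expectation_state_selection[OF integrable_square_diff])
  have "expectation (\<lambda>\<omega>. pair_energy (S \<omega> (Suc k))) =
      expectation (\<lambda>\<omega>. pair_energy (S \<omega> k) -
        (\<Sum>i\<in>UNIV. \<Sum>j\<in>UNIV. real CARD('n) * (?d i j \<omega> * ?I i j \<omega>)))"
  proof (rule integral_cong_AE)
    show "AE \<omega> in M. pair_energy (S \<omega> (Suc k)) = pair_energy (S \<omega> k) -
        (\<Sum>i\<in>UNIV. \<Sum>j\<in>UNIV. real CARD('n) * (?d i j \<omega> * ?I i j \<omega>))"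
      using dependent[of k] unfolding S_def
      by eventually_elim (rule pair_energy_state_Suc[OF _ assms(1)])
    show "(\<lambda>\<omega>. pair_energy (S \<omega> (Suc k))) \<in> borel_measurable M"
      unfolding S_def by (rule measurable_state_fun)
    show "(\<lambda>\<omega>. pair_energy (S \<omega> k) -
        (\<Sum>i\<in>UNIV. \<Sum>j\<in>UNIV. real CARD('n) * (?d i j \<omega> * ?I i j \<omega>))) \<in> borel_measurable M"
      unfolding S_def
      by (intro borel_measurable_diff borel_measurable_sum borel_measurable_times
          borel_measurable_const measurable_selection measurable_state_fun)
  qed
  also have "\<dots> = expectation (\<lambda>\<omega>. pair_energy (S \<omega> k)) -
      (\<Sum>i\<in>UNIV. \<Sum>j\<in>UNIV. real CARD('n) * expectation (\<lambda>\<omega>. ?d i j \<omega> * ?I i j \<omega>))"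
    using integrable_pair_energy[of k0 x0 k] int by (simp add: S_def)
  also have "(\<Sum>i\<in>UNIV. \<Sum>j\<in>UNIV. real CARD('n) * expectation (\<lambda>\<omega>. ?d i j \<omega> * ?I i j \<omega>)) =
      (\<Sum>i\<in>UNIV. \<Sum>j\<in>UNIV. Pp k * (A $ i $ j * expectation (?d i j)))"
    unfolding exp by (simp add: mult_ac)
  also have "\<dots> = Pp k * expectation (\<lambda>\<omega>. dirichlet_form A (S \<omega> k))"
    unfolding dirichlet_form_def using int by (simp add: sum_distrib_left)
  finally show ?thesis .
qed

text \<open>The Poincare inequality contracts the expected energy by the factor
  \<open>1 - Pp k / C\<close> at each time from \<open>k0\<close> on, and these contractions are
  iterated.\<close>

lemma expectation_pair_energy_le:
  assumes "weakly_connected (underlying_digraph A)"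
  shows "\<exists>C>0. \<forall>m. expectation (\<lambda>\<omega>. pair_energy (gossip_state sel Ep Em k0 x0 \<omega> (k0 + m)))
    \<le> pair_energy x0 * exp (- (\<Sum>j<m. Pp (j + k0)) / C)"
proof -
  let ?S = "gossip_state sel Ep Em k0 x0"
  let ?E = "\<lambda>k. expectation (\<lambda>\<omega>. pair_energy (?S \<omega> k))"
  obtain C where C: "C \<ge> 1" "\<And>x. pair_energy x \<le> C * dirichlet_form A x"
    using pair_energy_le_dirichlet_form[OF stochastic assms] by blast
  have E: "0 \<le> ?E k" for k
    by (simp add: pair_energy_nonneg)
  have step: "?E (Suc k) \<le> ?E k * exp (- Pp k / C)" if "k0 \<le> k" for k
  proof -
    have "integrable M (\<lambda>\<omega>. dirichlet_form A (?S \<omega> k))"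
      unfolding dirichlet_form_def
      by (intro Bochner_Integration.integrable_sum integrable_mult_right integrable_square_diff)
    then have "?E k \<le> expectation (\<lambda>\<omega>. C * dirichlet_form A (?S \<omega> k))"
      by (intro integral_mono integrable_pair_energy integrable_mult_right C)
    then have "?E k / C \<le> expectation (\<lambda>\<omega>. dirichlet_form A (?S \<omega> k))"
      using C(1) by (simp add: field_simps)
    then have "Pp k * (?E k / C) \<le> Pp k * expectation (\<lambda>\<omega>. dirichlet_form A (?S \<omega> k))"
      using Pp_range[of k] by (intro mult_left_mono) auto
    then have "?E (Suc k) \<le> ?E k * (1 + - Pp k / C)"
      unfolding expectation_pair_energy_Suc[OF that] by (simp add: field_simps)
    \<comment> \<open>The bound \<open>1 + t \<le> exp t\<close> lets the contraction factors
      multiply to the exponential of a sum.\<close>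
    also have "\<dots> \<le> ?E k * exp (- Pp k / C)"
      by (intro mult_left_mono exp_ge_add_one_self E)
    finally show ?thesis .
  qed
  have "?E (k0 + m) \<le> pair_energy x0 * exp (- (\<Sum>j<m. Pp (j + k0)) / C)" for m
  proof (induction m)
    case 0
    then show ?case by (simp add: gossip_state_initial prob_space)
  next
    case (Suc m)
    have "?E (k0 + Suc m) \<le> ?E (k0 + m) * exp (- Pp (k0 + m) / C)"
      using step[of "k0 + m"] by simp
    also have "\<dots> \<le> (pair_energy x0 * exp (- (\<Sum>j<m. Pp (j + k0)) / C)) * exp (- Pp (k0 + m) / C)"
      by (intro mult_right_mono Suc) auto
    also have "\<dots> = pair_energy x0 * exp (- (\<Sum>j<Suc m. Pp (j + k0)) / C)"
      by (simp add: exp_add[symmetric] add_divide_distrib add.commute diff_divide_distrib flip: mult.assoc)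
    finally show ?case .
  qed
  then show ?thesis
    using C(1) by (intro exI[of _ C]) auto
qed

text \<open>The energy decreases almost surely to a nonnegative limit. The expectation of the limit
  is below every expected energy, hence 0, so the limit vanishes almost surely.\<close>

lemma AE_spread_tendsto_0:
  assumes "weakly_connected (underlying_digraph A)" and "\<not> summable Pp"
  shows "AE \<omega> in M. (\<lambda>k. spread (gossip_state sel Ep Em k0 x0 \<omega> k)) \<longlonglongrightarrow> 0"
proof -
  let ?V = "\<lambda>k \<omega>. pair_energy (gossip_state sel Ep Em k0 x0 \<omega> k)"
  \<comment> \<open>Using \<open>lim\<close> gives a total measurable function; it is shown to be
    the actual limit only almost everywhere.\<close>
  let ?L = "\<lambda>\<omega>. lim (\<lambda>k. ?V k \<omega>)"
  obtain C where C: "C > 0"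
    "\<And>m. expectation (?V (k0 + m)) \<le> pair_energy x0 * exp (- (\<Sum>j<m. Pp (j + k0)) / C)"
    using expectation_pair_energy_le[OF assms(1)] by blast
  \<comment> \<open>Dropping the first \<open>k0\<close> terms preserves divergence. Since the terms
    are nonnegative, the partial sums then tend to infinity.\<close>
  have "\<not> summable (\<lambda>j. Pp (j + k0))"
    using assms(2) by (simp add: summable_iff_shift)
  have "filterlim (\<lambda>m. \<Sum>j<m. Pp (j + k0)) at_top sequentially"
    unfolding filterlim_at_top
  proof
    fix Z :: real
    have "\<not> (\<forall>N. (\<Sum>j<N. Pp (j + k0)) \<le> Z)"
      using summableI_nonneg_bounded[of "\<lambda>j. Pp (j + k0)" Z] Pp_range
        \<open>\<not> summable (\<lambda>j. Pp (j + k0))\<close> by auto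
    then obtain N where N: "Z < (\<Sum>j<N. Pp (j + k0))"
      by (auto simp: not_le)
    have "(\<Sum>j<N. Pp (j + k0)) \<le> (\<Sum>j<m. Pp (j + k0))" if "N \<le> m" for m
      using that Pp_range by (intro sum_mono2) auto
    with N show "\<forall>\<^sub>F m in sequentially. Z \<le> (\<Sum>j<m. Pp (j + k0))"
      by (intro eventually_sequentiallyI[of N]) (meson less_imp_le order_trans)
  qed
  then have "filterlim (\<lambda>m. (1 / C) * (\<Sum>j<m. Pp (j + k0))) at_top sequentially"
    using C(1) by (intro filterlim_tendsto_pos_mult_at_top[OF tendsto_const]) auto
  then have "filterlim (\<lambda>m. - (\<Sum>j<m. Pp (j + k0)) / C) at_bot sequentially"
    by (simp add: filterlim_uminus_at_top)
  then have lim0: "(\<lambda>m. pair_energy x0 * exp (- (\<Sum>j<m. Pp (j + k0)) / C)) \<longlonglongrightarrow> pair_energy x0 * 0"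
    by (intro tendsto_intros filterlim_compose[OF exp_at_bot])
  have conv: "AE \<omega> in M. (\<lambda>k. ?V k \<omega>) \<longlonglongrightarrow> ?L \<omega> \<and> (\<forall>k. ?L \<omega> \<le> ?V k \<omega>) \<and> 0 \<le> ?L \<omega>"
    using AE_dependent
  proof eventually_elim
    case (elim \<omega>)
    then have dec: "decseq (\<lambda>k. ?V k \<omega>)"
      by (intro pair_energy_state_decseq) auto
    then obtain l where "(\<lambda>k. ?V k \<omega>) \<longlonglongrightarrow> l"
      using decseq_convergent[OF dec, of 0] pair_energy_nonneg by blast
    then have lim: "(\<lambda>k. ?V k \<omega>) \<longlonglongrightarrow> ?L \<omega>"
      by (simp add: limI)
    then show ?case
      using decseq_ge[OF dec lim] LIMSEQ_le_const[OF lim, of 0] pair_energy_nonneg by blast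
  qed
  have L_meas: "?L \<in> borel_measurable M"
    by (intro borel_measurable_lim_metric measurable_state_fun)
  have "AE \<omega> in M. norm (?L \<omega>) \<le> norm (?V 0 \<omega>)"
    using conv
  proof eventually_elim
    case (elim \<omega>)
    then have "?L \<omega> \<le> ?V 0 \<omega>" "0 \<le> ?L \<omega>"
      by blast+
    then show ?case
      by (simp only: real_norm_def abs_of_nonneg pair_energy_nonneg)
  qed
  then have L_int: "integrable M ?L"
    by (rule Bochner_Integration.integrable_bound[OF integrable_pair_energy L_meas])
  have "expectation ?L \<le> pair_energy x0 * exp (- (\<Sum>j<m. Pp (j + k0)) / C)" for m
  proof -
    have "expectation ?L \<le> expectation (?V (k0 + m))"
      by (rule integral_mono_AE[OF L_int integrable_pair_energy]) (use conv in eventually_elim, auto)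
    with C(2)[of m] show ?thesis by linarith
  qed
  then have "expectation ?L \<le> 0"
    using LIMSEQ_le_const[OF lim0] by auto
  moreover have L_nonneg: "AE \<omega> in M. 0 \<le> ?L \<omega>"
    using conv by eventually_elim auto
  ultimately have "expectation ?L = 0"
    using integral_nonneg_AE by (metis order_antisym)
  then have "AE \<omega> in M. ?L \<omega> = 0"
    using integral_nonneg_eq_0_iff_AE[OF L_int L_nonneg] by simp
  with conv show ?thesis
  proof eventually_elim
    case (elim \<omega>)
    then have "(\<lambda>k. ?V k \<omega>) \<longlonglongrightarrow> 0"
      by metis
    then have "(\<lambda>k. sqrt (?V k \<omega>)) \<longlonglongrightarrow> 0"
      using tendsto_real_sqrt by fastforce
    then show ?case
      by (rule Lim_null_comparison[rotated]) (simp add: abs_spread_le)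
  qed
qed

end

section \<open>Positive probability of a frozen state\<close>

text \<open>Selecting \<open>(i, j)\<close> changes nothing while its two values agree, whatever is
  received. It suffices to select this pair up to some \<open>K\<close> and to have no reception
  afterwards; these two events are independent.\<close>

lemma prob_stationary_pos:
  assumes "summable Pp" "summable Pm" and "0 < A $ i $ j" and eq: "x0 $ i = x0 $ j"
  shows "0 < prob {\<omega> \<in> space M. \<forall>k. gossip_state sel Ep Em k0 x0 \<omega> k = x0}"
proof -
  have summable: "summable (\<lambda>k. Pp k + Pm k)"
    using assms by (intro summable_add)
  \<comment> \<open>\<open>K\<close> makes the tail of the series less than 1, so that the union
    bound leaves positive probability for no reception after \<open>K\<close>. The tail starts at
    \<open>Suc K\<close> because selections are fixed up to and including \<open>K\<close>.\<close>
  obtain K where "\<forall>n\<ge>K. norm (\<Sum>k. Pp (k + n) + Pm (k + n)) < 1"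
    using suminf_exist_split[OF _ summable, of 1] by auto
  then have "norm (\<Sum>k. Pp (k + Suc K) + Pm (k + Suc K)) < 1"
    using le_SucI[OF order_refl] by blast
  then have K: "(\<Sum>k. Pp (k + Suc K) + Pm (k + Suc K)) < 1"
    by simp
  let ?N = "\<lambda>I. PiM I (\<lambda>_. count_space UNIV) :: (nat + nat \<Rightarrow> ('n \<times> 'n) + (bool \<times> bool)) measure"
  let ?I = "Inl ` {..K} :: (nat + nat) set" and ?J = "Inr ` {Suc K..} :: (nat + nat) set"
  let ?X = "{z \<in> space (?N ?I). \<forall>c\<in>?I. z c = Inl (i, j)}"
  let ?Y = "{z \<in> space (?N ?J). \<forall>c\<in>?J. z c = Inr (False, False)}"
  define X where "X = {\<omega> \<in> space M. \<forall>k\<le>K. sel k \<omega> = (i, j)}"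
  define Y where "Y = {\<omega> \<in> space M. \<forall>k>K. \<omega> \<notin> Ep k \<and> \<omega> \<notin> Em k}"
  have sets: "?X \<in> sets (?N ?I)" "?Y \<in> sets (?N ?J)"
    by measurable
  have "X \<inter> Y = (\<lambda>\<omega>. (restrict (\<lambda>c. obs c \<omega>) ?I, restrict (\<lambda>c. obs c \<omega>) ?J)) -` (?X \<times> ?Y)
      \<inter> space M"
    by (auto simp: X_def Y_def space_PiM)
  then have "prob (X \<inter> Y) = prob ((\<lambda>\<omega>. restrict (\<lambda>c. obs c \<omega>) ?I) -` ?X \<inter> space M)
      * prob ((\<lambda>\<omega>. restrict (\<lambda>c. obs c \<omega>) ?J) -` ?Y \<inter> space M)"
    using indep_varD[OF indep_var_obs sets] by auto
  also have "(\<lambda>\<omega>. restrict (\<lambda>c. obs c \<omega>) ?I) -` ?X \<inter> space M = X"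
    by (auto simp: X_def space_PiM)
  also have "(\<lambda>\<omega>. restrict (\<lambda>c. obs c \<omega>) ?J) -` ?Y \<inter> space M = Y"
    by (auto simp: Y_def space_PiM)
  finally have prob_XY: "prob (X \<inter> Y) = prob X * prob Y" .
  \<comment> \<open>As an intersection over a finite index set, the event has the product of the
    single selection probabilities, each of them positive.\<close>
  have X_eq: "X = (\<Inter>c\<in>?I. obs c -` {Inl (i, j)} \<inter> space M)"
    by (auto simp: X_def)
  have "prob X = (\<Prod>c\<in>?I. prob (obs c -` {Inl (i, j)} \<inter> space M))"
    unfolding X_eq by (rule indep_varsD[OF independent]) auto
  also have "\<dots> = (\<Prod>k\<le>K. prob {\<omega> \<in> space M. sel k \<omega> = (i, j)})"
    by (subst prod.reindex) (auto intro!: prod.cong arg_cong[where f = prob])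
  also have "\<dots> > 0"
    using assms(3) by (intro prod_pos) (simp add: prob_sel)
  finally have X_pos: "prob X > 0" .
  let ?U = "\<lambda>k. Ep (k + Suc K) \<union> Em (k + Suc K)"
  have U_le: "prob (?U k) \<le> Pp (k + Suc K) + Pm (k + Suc K)" for k
    using measure_Un_le[OF Ep_event[of "k + Suc K"] Em_event[of "k + Suc K"]]
    by (simp add: prob_Ep prob_Em)
  have summable': "summable (\<lambda>k. Pp (k + Suc K) + Pm (k + Suc K))"
    using summable_ignore_initial_segment[OF summable] .
  have summable_U: "summable (\<lambda>k. prob (?U k))"
    by (rule summable_comparison_test'[OF summable', of 0]) (use U_le in simp)
  have "prob (\<Union>k. ?U k) \<le> (\<Sum>k. prob (?U k))"
    using Ep_event Em_event by (intro finite_measure_subadditive_countably summable_U) auto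
  also have "\<dots> \<le> (\<Sum>k. Pp (k + Suc K) + Pm (k + Suc K))"
    by (intro suminf_le U_le summable_U summable')
  finally have U: "prob (\<Union>k. ?U k) < 1"
    using K by linarith
  have Y_eq: "Y = space M - (\<Union>k. ?U k)"
  proof -
    have "k > K \<longleftrightarrow> (\<exists>l. k = l + Suc K)" for k
      by (auto simp: less_iff_Suc_add)
    then show ?thesis
      by (auto simp: Y_def)
  qed
  have "(\<Union>k. ?U k) \<in> events"
    using Ep_event Em_event by auto
  then have Y_pos: "prob Y > 0"
    using U unfolding Y_eq by (simp add: prob_compl)
  have "X \<inter> Y \<subseteq> {\<omega> \<in> space M. \<forall>k. gossip_state sel Ep Em k0 x0 \<omega> k = x0}"
  proof
    fix \<omega>
    assume \<omega>: "\<omega> \<in> X \<inter> Y"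
    have "gossip_step (sel k \<omega>) (\<omega> \<in> Ep k) (\<omega> \<in> Em k) x0 = x0" for k
      using \<omega> eq by (cases "k \<le> K") (auto simp: X_def Y_def gossip_step_trivial)
    then show "\<omega> \<in> {\<omega> \<in> space M. \<forall>k. gossip_state sel Ep Em k0 x0 \<omega> k = x0}"
      using \<omega> by (auto simp: X_def gossip_state_stationary)
  qed
  moreover have "{\<omega> \<in> space M. \<forall>k. gossip_state sel Ep Em k0 x0 \<omega> k = x0} \<in> events"
  proof -
    have "Measurable.pred M (\<lambda>\<omega>. gossip_state sel Ep Em k0 x0 \<omega> k = x0)" for k
      by (rule measurable_compose[OF measurable_state]) simp
    then have "Measurable.pred M (\<lambda>\<omega>. \<forall>k. gossip_state sel Ep Em k0 x0 \<omega> k = x0)"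
      by (rule pred_intros_countable)
    then show ?thesis
      by (simp add: pred_def)
  qed
  ultimately have "prob (X \<inter> Y) \<le> prob {\<omega> \<in> space M. \<forall>k. gossip_state sel Ep Em k0 x0 \<omega> k = x0}"
    by (rule finite_measure_mono)
  then show ?thesis
    using X_pos Y_pos unfolding prob_XY by (meson less_le_trans mult_pos_pos)
qed

section \<open>Consensus as an almost sure statement, and its failure\<close>

text \<open>Measurability of the convergence set allows probability one to be read as almost
  everywhere.\<close>

lemma consensus_event:
  "{\<omega> \<in> space M. (\<lambda>k. spread (gossip_state sel Ep Em k0 x0 \<omega> k)) \<longlonglongrightarrow> 0} \<in> events"
proof -
  have "Measurable.pred M (\<lambda>\<omega>. (\<lambda>k. spread (gossip_state sel Ep Em k0 x0 \<omega> k)) \<longlonglongrightarrow> 0)"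
    by (intro measurable_limit2 measurable_state_fun borel_measurable_const)
  then show ?thesis
    by (simp add: pred_def)
qed

lemma global_as_consensus_iff_AE:
  "global_as_consensus M sel Ep Em k0 \<longleftrightarrow>
    (\<forall>x0. AE \<omega> in M. (\<lambda>k. spread (gossip_state sel Ep Em k0 x0 \<omega> k)) \<longlonglongrightarrow> 0)"
  unfolding global_as_consensus_def by (simp add: prob_Collect_eq_1[OF consensus_event])

lemma ex_positive_entry: "\<exists>i j. 0 < A $ i $ j"
proof (rule ccontr)
  assume "\<not> ?thesis"
  then have "(\<Sum>j\<in>UNIV. A $ i $ j) \<le> 0" for i
    by (intro sum_nonpos) (auto simp: not_less)
  then show False
    using stochastic by (auto simp: stochastic_matrix_def)
qed

text \<open>With at least three nodes, some node lies outside a selectable pair. Giving it a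
  different value yields a nonconstant state that stays frozen with positive probability.\<close>

lemma summable_imp_no_consensus:
  assumes card: "CARD('n) \<ge> 3" and summable: "summable Pp" "summable Pm"
  shows "\<not> global_as_consensus M sel Ep Em k0"
proof
  assume cons: "global_as_consensus M sel Ep Em k0"
  obtain i j where ij: "0 < A $ i $ j"
    using ex_positive_entry by blast
  have "card {i, j} < CARD('n)"
    using card by (intro le_less_trans[OF card_insert_le_m1]) auto
  then have "{i, j} \<noteq> UNIV"
    by auto
  then obtain m where m: "m \<noteq> i" "m \<noteq> j"
    by auto
  \<comment> \<open>The unit vector at \<open>m\<close> is 0 at both \<open>i\<close> and
    \<open>j\<close>, so the pair agrees, while the spread is at least 1.\<close>
  define x0 :: "real ^ 'n" where "x0 = axis m 1"
  let ?B = "{\<omega> \<in> space M. \<forall>k. gossip_state sel Ep Em k0 x0 \<omega> k = x0}"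
  have x0: "x0 $ i = 0" "x0 $ j = 0" "x0 $ m = 1"
    using m by (auto simp: x0_def axis_def)
  then have "0 < prob ?B"
    by (intro prob_stationary_pos[OF summable ij]) simp
  have "spread x0 \<ge> 1"
    using diff_le_spread[of x0 m i] x0 by simp
  have "AE \<omega> in M. \<not> (\<forall>k. gossip_state sel Ep Em k0 x0 \<omega> k = x0)"
    using cons[unfolded global_as_consensus_iff_AE, rule_format, of x0]
  proof (elim eventually_mono, intro notI)
    fix \<omega>
    assume "(\<lambda>k. spread (gossip_state sel Ep Em k0 x0 \<omega> k)) \<longlonglongrightarrow> 0"
      "\<forall>k. gossip_state sel Ep Em k0 x0 \<omega> k = x0"
    then have "spread x0 = 0"
      by (simp add: LIMSEQ_const_iff)
    with \<open>spread x0 \<ge> 1\<close> show False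
      by simp
  qed
  then have "prob ?B = 0"
    by (simp only: measure_def emeasure_eq_0_AE enn2real_0)
  with \<open>0 < prob ?B\<close> show False by simp
qed

end

theorem theorem1:
  fixes M :: "'a measure"
    and A :: "real ^ 'n ^ 'n"
    and P :: "nat \<Rightarrow> real"
    and sel :: "nat \<Rightarrow> 'a \<Rightarrow> 'n \<times> 'n"
    and Ep Em :: "nat \<Rightarrow> 'a set"
    and k0 :: nat
  assumes "CARD('n) \<ge> 3"
    and "gossip_model M A P P sel Ep Em"
    and "weakly_connected (underlying_digraph A)"
    and "\<And>k. AE \<omega> in M. \<omega> \<in> Ep k \<longleftrightarrow> \<omega> \<in> Em k"
  shows "global_as_consensus M sel Ep Em k0 \<longleftrightarrow> (\<Sum>k. ennreal (P k)) = \<infinity>"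
proof -
  interpret gossip_model M A P P sel Ep Em
    by fact
  have nonneg: "0 \<le> P k" for k
    using Pp_range[of k] by simp
  \<comment> \<open>Nonnegativity of the terms translates divergence in the extended reals into
    failure of summability.\<close>
  have "(\<Sum>k. ennreal (P k)) = \<infinity> \<longleftrightarrow> \<not> summable P"
    using summable_suminf_not_top[of P, OF nonneg] ennreal_suminf_neq_top[of P, OF _ nonneg]
    by (metis infinity_ennreal_def)
  moreover have "global_as_consensus M sel Ep Em k0" if "\<not> summable P"
    unfolding global_as_consensus_iff_AE
    using AE_spread_tendsto_0[OF assms(4,3) that] by blast
  moreover have "\<not> global_as_consensus M sel Ep Em k0" if "summable P"
    by (rule summable_imp_no_consensus[OF assms(1) that that])
  ultimately show ?thesis by blast
qed

end
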